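(* Let $k$ be a nonzero commutative unital ring and $m>1$. Then the regular cyclic $(m+1)$-ary algebra $\mathcal T_m(k)$ has no polyadic unit. In particular, it is not obtained as the iterated $n$-fold multiplication ($n=m+1$) of a unital binary (associative) algebra on the same underlying $k$-module.
   Context: $\mathcal T_m(k)$ is the $k$-algebra of functions $k^{C_m}$ (pointwise multiplication, $C_m=\mathbb Z/m$ written additively, $\varepsilon_t$ the characteristic function of $t\in C_m$) with the automorphism $\sigma(\varepsilon_t)=\varepsilon_{t+1}$ and the $(m+1)$-ary product $[a_0,\ldots,a_m]=a_0\sigma(a_1)\cdots\sigma^{m-1}(a_{m-1})a_m$. A polyadic unit of an $n$-ary algebra is an element $e$ such that for every position $i$ and every element $f$, the $n$-ary product with $f$ in position $i$ and $e$ in all other positions equals $f$. *)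

theory Defs
  imports "HOL-Library.Function_Algebras" "Berlekamp_Zassenhaus.Finite_Field"
begin

text \<open>
  The group \<open>C_m = \<int>/m\<close> is the additive group of the type \<open>'m mod_ring\<close>, where \<open>m = CARD('m)\<close>,
  and the \<open>k\<close>-algebra of functions on \<open>C_m\<close> with values in \<open>k\<close> is the type \<open>'m mod_ring \<Rightarrow> 'k\<close> with
  the pointwise operations of \<^theory>\<open>HOL-Library.Function_Algebras\<close>. For \<open>'m :: finite\<close> the type
  \<open>'m mod_ring\<close> has no constant \<open>1\<close> (it is a unital ring in the type class sense only for
  \<open>m > 1\<close>), so the residue class of \<open>1\<close> is written \<open>of_int_mod_ring 1\<close>.
\<close>

definition scale_fun :: "'k::comm_ring_1 \<Rightarrow> ('a \<Rightarrow> 'k) \<Rightarrow> ('a \<Rightarrow> 'k)" where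
  "scale_fun c f = (\<lambda>t. c * f t)"

definition char_fun :: "'a \<Rightarrow> ('a \<Rightarrow> 'k::comm_ring_1)" where
  "char_fun t = (\<lambda>s. if s = t then 1 else 0)"

definition shift :: "('m::finite mod_ring \<Rightarrow> 'k::comm_ring_1) \<Rightarrow> ('m mod_ring \<Rightarrow> 'k)" where
  "shift f = (\<lambda>t. f (t - of_int_mod_ring 1))"

text \<open>An \<open>n\<close>-ary operation is represented by a function on lists, of which only the values on lists
  of length \<open>n\<close> are relevant.\<close>

text \<open>The product \<open>a_0 \<sigma>(a_1) \<dots> \<sigma>^(m-1)(a_(m-1)) a_m\<close>, for lists of length \<open>m + 1\<close>.\<close>

definition cyclic_prod :: "('m::finite mod_ring \<Rightarrow> 'k::comm_ring_1) list \<Rightarrow> ('m mod_ring \<Rightarrow> 'k)" where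
  "cyclic_prod as = (\<Prod>i<CARD('m). (shift ^^ i) (as ! i)) * as ! CARD('m)"

definition polyadic_unit :: "nat \<Rightarrow> ('a list \<Rightarrow> 'a) \<Rightarrow> 'a \<Rightarrow> bool" where
  "polyadic_unit n p e \<longleftrightarrow> (\<forall>i<n. \<forall>f. p ((replicate n e)[i := f]) = f)"

definition unital_assoc_algebra ::
  "('k::comm_ring_1 \<Rightarrow> 'a::ab_group_add \<Rightarrow> 'a) \<Rightarrow> ('a \<Rightarrow> 'a \<Rightarrow> 'a) \<Rightarrow> 'a \<Rightarrow> bool" where
  "unital_assoc_algebra scale mul u \<longleftrightarrow>
     Modules.module scale \<and>
     (\<forall>x. module_hom scale scale (\<lambda>y. mul x y)) \<and>
     (\<forall>y. module_hom scale scale (\<lambda>x. mul x y)) \<and>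
     (\<forall>x y z. mul (mul x y) z = mul x (mul y z)) \<and>
     (\<forall>x. mul u x = x \<and> mul x u = x)"

text \<open>\<open>a_1 \<cdot> a_2 \<cdot> \<dots> \<cdot> a_n\<close>, for nonempty lists\<close>

definition iterated_mult :: "('a \<Rightarrow> 'a \<Rightarrow> 'a) \<Rightarrow> 'a list \<Rightarrow> 'a" where
  "iterated_mult mul as = foldl mul (hd as) (tl as)"

lemma module_scale_fun: "Modules.module scale_fun"
  by unfold_locales (auto simp: scale_fun_def fun_eq_iff algebra_simps)

lemma bij_shift: "bij shift"
  by (rule bij_betw_byWitness[where f' = "\<lambda>f t. f (t + of_int_mod_ring 1)"]) (auto simp: shift_def)

lemma module_hom_shift: "module_hom scale_fun scale_fun shift"
  by (intro module_hom.intro module_hom_axioms.intro module_scale_fun)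
     (auto simp: scale_fun_def shift_def fun_eq_iff)

lemma shift_mult: "shift (f * g) = shift f * shift g"
  by (auto simp: shift_def fun_eq_iff)

lemma shift_one: "shift 1 = 1"
  by (auto simp: shift_def fun_eq_iff)

lemma shift_char_fun: "shift (char_fun t) = char_fun (t + of_int_mod_ring 1)"
  by (auto simp: shift_def char_fun_def fun_eq_iff diff_eq_eq)

lemma sum_char_fun: "f = (\<Sum>t\<in>UNIV. scale_fun (f t) (char_fun t))"
  for f :: "'a::finite \<Rightarrow> 'k::comm_ring_1"
proof
  have sum_apply: "(\<Sum>t\<in>A. g t) s = (\<Sum>t\<in>A. g t s)"
    for A s and g :: "'a \<Rightarrow> 'a \<Rightarrow> 'k"
    by (induction A rule: infinite_finite_induct) auto
  show "f s = (\<Sum>t\<in>UNIV. scale_fun (f t) (char_fun t)) s" for s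
    by (simp add: sum_apply scale_fun_def char_fun_def if_distrib cong: if_cong)
qed

lemma shift_unique:
  fixes \<sigma> :: "('m::finite mod_ring \<Rightarrow> 'k::comm_ring_1) \<Rightarrow> ('m mod_ring \<Rightarrow> 'k)"
  assumes "module_hom scale_fun scale_fun \<sigma>"
    and "\<And>t. \<sigma> (char_fun t) = char_fun (t + of_int_mod_ring 1)"
  shows "\<sigma> = shift"
proof
  fix f
  interpret s: module_hom scale_fun scale_fun \<sigma> by fact
  interpret h: module_hom scale_fun scale_fun "shift :: ('m mod_ring \<Rightarrow> 'k) \<Rightarrow> _"
    by (rule module_hom_shift)
  have "\<sigma> (\<Sum>t\<in>UNIV. scale_fun (f t) (char_fun t)) = shift (\<Sum>t\<in>UNIV. scale_fun (f t) (char_fun t))"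
    by (simp add: s.sum h.sum s.scale h.scale assms(2) shift_char_fun)
  then show "\<sigma> f = shift f"
    by (simp flip: sum_char_fun)
qed

end

theory Submission
  imports Defs
begin

text \<open>
  The obstruction lies in the second position, whose entry enters the product through exactly one
  shift. For \<open>m > 1\<close> this is not the last position, so the product is a multiple of \<open>\<sigma>(a_1)\<close> in the
  pointwise algebra and vanishes wherever \<open>\<sigma>(a_1)\<close> does. If \<open>e\<close> were a polyadic unit, putting
  \<open>f = \<epsilon>_0\<close> there would present \<open>\<epsilon>_0\<close> as a multiple of \<open>\<sigma>(\<epsilon>_0) = \<epsilon>_1\<close>; but \<open>\<epsilon>_1\<close> is zero at \<open>0\<close>,
  where \<open>\<epsilon>_0\<close> is \<open>1 \<noteq> 0\<close>.

  The second assertion follows: a two-sided unit of a binary multiplication is a polyadic unit of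
  its iterates.
\<close>

lemma of_int_mod_ring_1_neq_0:
  assumes "CARD('m::finite) > 1"
  shows "(of_int_mod_ring 1 :: 'm mod_ring) \<noteq> 0"
  using assms by transfer simp

lemma cyclic_prod_dvd_shift_second:
  fixes as :: "('m::finite mod_ring \<Rightarrow> 'k::comm_ring_1) list"
  assumes "CARD('m) > 1"
  shows "shift (as ! 1) dvd cyclic_prod as"
proof -
  have "(shift ^^ 1) (as ! 1) dvd (\<Prod>i<CARD('m). (shift ^^ i) (as ! i))"
    using assms by (intro dvd_prodI) auto
  then show ?thesis
    by (simp add: cyclic_prod_def)
qed

lemma cyclic_prod_no_polyadic_unit:
  fixes e :: "'m::finite mod_ring \<Rightarrow> 'k::comm_ring_1"
  assumes "CARD('m) > 1"
  shows "\<not> polyadic_unit (CARD('m) + 1) cyclic_prod e"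
proof
  define f :: "'m mod_ring \<Rightarrow> 'k" where "f = char_fun 0"
  define as where "as = (replicate (CARD('m) + 1) e)[1 := f]"
  assume "polyadic_unit (CARD('m) + 1) cyclic_prod e"
  then have "cyclic_prod as = f"
    using assms unfolding polyadic_unit_def as_def by (metis trans_less_add1)
  moreover have "as ! 1 = f"
    using assms by (simp add: as_def)
  ultimately have "shift f dvd f"
    using cyclic_prod_dvd_shift_second[OF assms, of as] by simp
  then obtain g where "f = shift f * g" ..
  then have "f 0 = shift f 0 * g 0"
    by (metis times_fun_apply)
  moreover have "shift f 0 = 0"
    using of_int_mod_ring_1_neq_0[OF assms] by (simp add: f_def shift_char_fun) (simp add: char_fun_def)
  moreover have "f 0 = 1"
    by (simp add: f_def char_fun_def)
  ultimately show False
    by simp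
qed

lemma polyadic_unit_iterated_mult:
  assumes left: "\<And>x. mul u x = x" and right: "\<And>x. mul x u = x"
  shows "polyadic_unit n (iterated_mult mul) u"
  unfolding polyadic_unit_def
proof (intro allI impI)
  fix i f assume "i < n"
  have absorb: "foldl mul x (replicate k u) = x" for x k
    by (induction k) (simp_all add: right)
  have "(replicate n u)[i := f] = replicate i u @ f # replicate (n - Suc i) u"
    using \<open>i < n\<close> by (simp add: upd_conv_take_nth_drop)
  then show "iterated_mult mul ((replicate n u)[i := f]) = f"
    by (cases i) (simp_all add: iterated_mult_def absorb left)
qed

theorem proposition4p6:
  assumes "CARD('m::finite) > 1"
  shows "(\<nexists>e. polyadic_unit (CARD('m) + 1)
            (cyclic_prod :: ('m mod_ring \<Rightarrow> 'k::comm_ring_1) list \<Rightarrow> _) e) \<and>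
         (\<nexists>(mul :: ('m mod_ring \<Rightarrow> 'k) \<Rightarrow> ('m mod_ring \<Rightarrow> 'k) \<Rightarrow> ('m mod_ring \<Rightarrow> 'k)) u.
            unital_assoc_algebra (scale_fun :: 'k \<Rightarrow> _) mul u \<and>
            (\<forall>as. length as = CARD('m) + 1 \<longrightarrow> cyclic_prod as = iterated_mult mul as))"
proof (intro conjI notI; elim exE conjE)
  fix e :: "'m mod_ring \<Rightarrow> 'k"
  assume "polyadic_unit (CARD('m) + 1) cyclic_prod e"
  then show False
    using cyclic_prod_no_polyadic_unit[OF assms] by blast
next
  fix mul :: "('m mod_ring \<Rightarrow> 'k) \<Rightarrow> ('m mod_ring \<Rightarrow> 'k) \<Rightarrow> ('m mod_ring \<Rightarrow> 'k)" and u
  assume "unital_assoc_algebra scale_fun mul u"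
    and eq: "\<forall>as. length as = CARD('m) + 1 \<longrightarrow> cyclic_prod as = iterated_mult mul as"
  then have "polyadic_unit (CARD('m) + 1) (iterated_mult mul) u"
    by (intro polyadic_unit_iterated_mult) (auto simp: unital_assoc_algebra_def)
  then have "polyadic_unit (CARD('m) + 1) cyclic_prod u"
    using eq unfolding polyadic_unit_def by (metis length_list_update length_replicate)
  then show False
    using cyclic_prod_no_polyadic_unit[OF assms] by blast
qed

end
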